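(* Let $x,y\in\mathbb{R}^n$ with $x^Ty\neq 0$ and let $u>0$. Let $\delta_1,\ldots,\delta_n,\theta_1,\ldots,\theta_n$ be independent random variables with $\mathbb{E}[\delta_k]=\mathbb{E}[\theta_k]=0$ and $|\delta_k|,|\theta_k|\leq u$ for $1\leq k\leq n$, and let $\hat{x},\hat{y}$ be the random vectors with components $\hat{x}_k=(1+\delta_k)x_k$ and $\hat{y}_k=(1+\theta_k)y_k$, $1\leq k\leq n$. Then for any $0<\delta<1$, with probability at least $1-\delta$, $$\left|\frac{\hat{x}^T\hat{y}-x^Ty}{x^Ty}\right| \leq \frac{\|x\circ y\|_2}{|x^Ty|}\,\sqrt{2\ln(2/\delta)}\;u(2+u)=\frac{\sqrt{\sum_{k=1}^n|x_ky_k|^2}}{|x^Ty|}\,\sqrt{2\ln(2/\delta)}\;u(2+u).$$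
   Context: Here $\circ$ denotes the Hadamard (componentwise) product, $x\circ y=(x_1y_1,\ldots,x_ny_n)^T$. The vectors $x,y$ are fixed (deterministic). The scalar $\delta$ (failure probability) is unrelated to the random variables $\delta_k$. *)

theory Defs
  imports "HOL-Probability.Probability"
begin

(* Multiplication on the vector type is componentwise (times_vec_def). *)
abbreviation hadamard :: "real ^ 'n \<Rightarrow> real ^ 'n \<Rightarrow> real ^ 'n"  (infixl \<open>\<circ>\<^sub>H\<close> 70)
  where "x \<circ>\<^sub>H y \<equiv> x * y"

definition perturbed :: "('n \<Rightarrow> 'a \<Rightarrow> real) \<Rightarrow> real ^ 'n \<Rightarrow> 'a \<Rightarrow> real ^ 'n"
  where "perturbed \<epsilon> x \<omega> = (\<chi> k. (1 + \<epsilon> k \<omega>) * x $ k)"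

end

theory Submission
  imports Defs
begin

text \<open>
  The error of the computed inner product is a sum of independent bounded variables with mean
  zero, and Hoeffding's inequality applies to it. Indeed
  \[ \hat x^T \hat y - x^T y = \sum_k x_k y_k\,(\delta_k + \theta_k + \delta_k\theta_k). \]
  Each summand depends only on its own pair $(\delta_k, \theta_k)$, so the summands inherit
  independence from the family of all perturbations (\<open>indep_vars_pairing\<close>). Inside a pair
  the two perturbations are independent, hence $\delta_k\theta_k$ also has mean zero
  (\<open>relative_error_mean_zero\<close>). Finally
  $|\delta_k + \theta_k + \delta_k\theta_k| \le 2u + u^2 = u(2+u)$.

  For variables with mean zero in symmetric intervals $[-c_k, c_k]$, Hoeffding's bound
  $2\exp(-2t^2/\sum_k (2c_k)^2)$ on the tail beyond $t$ equals $\eta$ exactly for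
  $t = \sqrt{2\ln(2/\eta)}\,\sqrt{\sum_k c_k^2}$ (\<open>Hoeffding_confidence_bound\<close>). Here
  $c_k = |x_k y_k|\,u(2+u)$, so that $\sqrt{\sum_k c_k^2} = \|x \circ y\|_2\,u(2+u)$, and
  dividing by $|x^T y|$ gives the relative error.
\<close>

text \<open>
  Functions of disjoint parts of an independent family are independent. The parts here
  are the pairs of variables with a common index, taken from two families that are
  jointly independent.
\<close>
lemma (in prob_space) indep_vars_pairing:
  fixes X :: "'i \<Rightarrow> 'a \<Rightarrow> 'b::topological_space"
    and Y :: "'i \<Rightarrow> 'a \<Rightarrow> 'b"
  assumes indep: "indep_vars (\<lambda>_. borel) (case_sum X Y) UNIV"
    and meas: "\<And>k. case_prod (f k) \<in> measurable (borel \<Otimes>\<^sub>M borel) (N k)"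
  shows "indep_vars N (\<lambda>k \<omega>. f k (X k \<omega>) (Y k \<omega>)) UNIV"
proof -
  define block :: "'i \<Rightarrow> ('i + 'i) set" where "block k = {Inl k, Inr k}" for k
  have "indep_vars (\<lambda>k. PiM (block k) (\<lambda>_. borel))
          (\<lambda>k \<omega>. restrict (\<lambda>i. case_sum X Y i \<omega>) (block k)) UNIV"
    by (rule indep_vars_restrict[OF indep]) (auto simp: block_def disjoint_family_on_def)
  then have "indep_vars N
      (\<lambda>k \<omega>. (\<lambda>g. case_prod (f k) (g (Inl k), g (Inr k)))
                (restrict (\<lambda>i. case_sum X Y i \<omega>) (block k))) UNIV"
  proof (rule indep_vars_compose2)
    fix k
    have "(\<lambda>g. (g (Inl k), g (Inr k))) \<in> measurable (PiM (block k) (\<lambda>_. borel)) (borel \<Otimes>\<^sub>M borel)"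
      by (intro measurable_Pair measurable_component_singleton) (auto simp: block_def)
    then show "(\<lambda>g. case_prod (f k) (g (Inl k), g (Inr k)))
        \<in> measurable (PiM (block k) (\<lambda>_. borel)) (N k)"
      by (rule measurable_compose[OF _ meas])
  qed
  then show ?thesis
    by (simp add: block_def)
qed

lemma (in prob_space) relative_error_mean_zero:
  fixes X Y :: "'a \<Rightarrow> real"
  assumes indep: "indep_var borel X borel Y"
    and int: "integrable M X" "integrable M Y"
    and mean: "expectation X = 0" "expectation Y = 0"
  shows "expectation (\<lambda>\<omega>. (1 + X \<omega>) * (1 + Y \<omega>) - 1) = 0"
proof -
  have "integrable M (\<lambda>\<omega>. X \<omega> * Y \<omega>)"
    by (rule indep_var_integrable[OF indep int])
  moreover have "expectation (\<lambda>\<omega>. X \<omega> * Y \<omega>) = 0"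
    by (simp add: indep_var_lebesgue_integral[OF indep int] mean)
  moreover have "(\<lambda>\<omega>. (1 + X \<omega>) * (1 + Y \<omega>) - 1) = (\<lambda>\<omega>. X \<omega> + Y \<omega> + X \<omega> * Y \<omega>)"
    by (auto simp: algebra_simps)
  ultimately show ?thesis
    using int mean by simp
qed

lemma relative_error_bound:
  fixes a b u :: real
  assumes "\<bar>a\<bar> \<le> u" "\<bar>b\<bar> \<le> u"
  shows "\<bar>(1 + a) * (1 + b) - 1\<bar> \<le> u * (2 + u)"
proof -
  have "\<bar>(1 + a) * (1 + b) - 1\<bar> = \<bar>a + b + a * b\<bar>"
    by (simp add: algebra_simps)
  also have "\<dots> \<le> \<bar>a\<bar> + \<bar>b\<bar> + \<bar>a\<bar> * \<bar>b\<bar>"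
    using abs_triangle_ineq[of "a + b" "a * b"] abs_triangle_ineq[of a b]
    unfolding abs_mult by linarith
  also have "\<dots> \<le> u + u + u * u"
    using assms by (intro add_mono mult_mono) auto
  finally show ?thesis
    by (simp add: algebra_simps)
qed

text \<open>
  Hoeffding's inequality solved for the deviation: the radius is the one at which the
  two-sided tail bound takes the prescribed value \<open>\<eta>\<close>. The factor 2 under the root
  comes from intervals of length \<open>2 * c i\<close>. The positivity of the sum excludes the
  degenerate case, in which the exponent of the tail bound would be a division by zero.
\<close>
lemma (in prob_space) Hoeffding_confidence_bound:
  fixes X :: "'i \<Rightarrow> 'a \<Rightarrow> real"
  assumes fin: "finite I"
    and indep: "indep_vars (\<lambda>_. borel) X I"
    and bound: "\<And>i. i \<in> I \<Longrightarrow> AE \<omega> in M. \<bar>X i \<omega>\<bar> \<le> c i"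
    and mean: "\<And>i. i \<in> I \<Longrightarrow> expectation (X i) = 0"
    and pos: "(\<Sum>i\<in>I. (c i)\<^sup>2) > 0"
    and \<eta>: "0 < \<eta>" "\<eta> < 1"
  shows "prob {\<omega>\<in>space M. \<bar>\<Sum>i\<in>I. X i \<omega>\<bar>
            \<le> sqrt (2 * ln (2 / \<eta>)) * sqrt (\<Sum>i\<in>I. (c i)\<^sup>2)} \<ge> 1 - \<eta>"
proof -
  define S where "S = (\<Sum>i\<in>I. (c i)\<^sup>2)"
  define t where "t = sqrt (2 * ln (2 / \<eta>)) * sqrt S"
  interpret Hoeffding_ineq M I X "\<lambda>i. - c i" c "\<Sum>i\<in>I. expectation (X i)"
  proof unfold_locales
    show "AE \<omega> in M. X i \<omega> \<in> {- c i..c i}" if "i \<in> I" for i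
      using bound[OF that] by eventually_elim auto
  qed (use fin indep in auto)
  have ln_pos: "ln (2 / \<eta>) > 0"
    using \<eta> by simp
  have S_pos: "S > 0"
    using pos by (simp add: S_def)
  have widths: "(\<Sum>i\<in>I. (c i - - c i)\<^sup>2) = 4 * S"
    by (simp add: S_def sum_distrib_left power2_eq_square algebra_simps)
  have "prob {\<omega>\<in>space M. \<bar>(\<Sum>i\<in>I. X i \<omega>) - 0\<bar> \<ge> t} \<le> 2 * exp (-2 * t\<^sup>2 / (4 * S))"
    using Hoeffding_ineq_abs_ge[of t] ln_pos S_pos
    unfolding widths by (simp add: t_def mean)
  also have "-2 * t\<^sup>2 / (4 * S) = - ln (2 / \<eta>)"
    using ln_pos S_pos by (simp add: t_def power_mult_distrib)
  also have "2 * exp (- ln (2 / \<eta>)) = \<eta>"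
    using \<eta> by (simp add: exp_minus)
  finally have tail: "prob {\<omega>\<in>space M. \<bar>\<Sum>i\<in>I. X i \<omega>\<bar> \<ge> t} \<le> \<eta>"
    by simp
  \<comment> \<open>The two events below overlap where the deviation is exactly \<open>t\<close>, which is harmless:
     they cover the space, so their probabilities add up to at least 1.\<close>
  have "1 = prob (space M)"
    by (simp add: prob_space)
  also have "\<dots> \<le> prob ({\<omega>\<in>space M. \<bar>\<Sum>i\<in>I. X i \<omega>\<bar> \<le> t} \<union> {\<omega>\<in>space M. \<bar>\<Sum>i\<in>I. X i \<omega>\<bar> \<ge> t})"
    by (intro finite_measure_mono) auto
  also have "\<dots> \<le> prob {\<omega>\<in>space M. \<bar>\<Sum>i\<in>I. X i \<omega>\<bar> \<le> t} + prob {\<omega>\<in>space M. \<bar>\<Sum>i\<in>I. X i \<omega>\<bar> \<ge> t}"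
    by (intro measure_Un_le) measurable
  finally show ?thesis
    using tail by (simp add: t_def S_def)
qed

lemma norm_hadamard:
  fixes x y :: "real ^ 'n"
  shows "norm (x \<circ>\<^sub>H y) = sqrt (\<Sum>k\<in>UNIV. \<bar>x $ k * y $ k\<bar>\<^sup>2)"
  by (simp add: norm_vec_def L2_set_def)

lemma hadamard_eq_0_imp_inner_eq_0:
  fixes x y :: "real ^ 'n"
  assumes "x \<circ>\<^sub>H y = 0"
  shows "x \<bullet> y = 0"
  using assms by (auto simp: vec_eq_iff inner_vec_def intro!: sum.neutral)

lemma inner_perturbed_diff:
  "perturbed \<delta> x \<omega> \<bullet> perturbed \<theta> y \<omega> - x \<bullet> y
     = (\<Sum>k\<in>UNIV. x $ k * y $ k * ((1 + \<delta> k \<omega>) * (1 + \<theta> k \<omega>) - 1))"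
  by (simp add: perturbed_def inner_vec_def algebra_simps flip: sum_subtractf)

theorem theorem2p4:
  fixes M :: "'a measure"
    and x y :: "real ^ 'n"
    and u \<eta> :: real
    and \<delta> \<theta> :: "'n \<Rightarrow> 'a \<Rightarrow> real"
  assumes "prob_space M"
    and "x \<bullet> y \<noteq> 0"
    and "u > 0"
    and "prob_space.indep_vars M (\<lambda>_. borel) (case_sum \<delta> \<theta>) (UNIV :: ('n + 'n) set)"
    and "\<And>k. prob_space.expectation M (\<delta> k) = 0"
    and "\<And>k. prob_space.expectation M (\<theta> k) = 0"
    and "\<And>k. AE \<omega> in M. \<bar>\<delta> k \<omega>\<bar> \<le> u"
    and "\<And>k. AE \<omega> in M. \<bar>\<theta> k \<omega>\<bar> \<le> u"
    and "0 < \<eta>" and "\<eta> < 1"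
  shows "prob_space.prob M {\<omega> \<in> space M.
            \<bar>(perturbed \<delta> x \<omega> \<bullet> perturbed \<theta> y \<omega> - x \<bullet> y) / (x \<bullet> y)\<bar>
              \<le> norm (x \<circ>\<^sub>H y) / \<bar>x \<bullet> y\<bar> * sqrt (2 * ln (2 / \<eta>)) * u * (2 + u)}
           \<ge> 1 - \<eta>
       \<and> norm (x \<circ>\<^sub>H y) / \<bar>x \<bullet> y\<bar> * sqrt (2 * ln (2 / \<eta>)) * u * (2 + u)
         = sqrt (\<Sum>k\<in>UNIV. \<bar>x $ k * y $ k\<bar>\<^sup>2) / \<bar>x \<bullet> y\<bar> * sqrt (2 * ln (2 / \<eta>)) * u * (2 + u)"
proof -
  interpret prob_space M by fact
  note indep = assms(4)
  define E where "E k \<omega> = x $ k * y $ k * ((1 + \<delta> k \<omega>) * (1 + \<theta> k \<omega>) - 1)" for k \<omega>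
  define c where "c k = \<bar>x $ k * y $ k\<bar> * (u * (2 + u))" for k

  have meas: "\<delta> k \<in> borel_measurable M" "\<theta> k \<in> borel_measurable M" for k
    using indep by (auto simp: indep_vars_def2 dest: spec[of _ "Inl k"] spec[of _ "Inr k"])
  have int: "integrable M (\<delta> k)" "integrable M (\<theta> k)" for k
    using assms(7,8) meas by (auto intro!: integrable_const_bound[where B = u])

  have E_indep: "indep_vars (\<lambda>_. borel) E UNIV"
    unfolding E_def
    by (rule indep_vars_pairing[OF indep,
          where f = "\<lambda>k a b. x $ k * y $ k * ((1 + a) * (1 + b) - 1)"]) measurable
  have E_mean: "expectation (E k) = 0" for k
  proof -
    \<comment> \<open>A variable is independent of the sum of the others in its family; with only one
       other variable, this is independence of the two.\<close>
    have "indep_var borel (\<delta> k) borel (\<theta> k)"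
      using indep_vars_sum[of "{Inr k}" "Inl k" "case_sum \<delta> \<theta>"]
        indep_vars_subset[OF indep, of "{Inl k, Inr k}"] by simp
    from relative_error_mean_zero[OF this int assms(5,6)] show ?thesis
      by (simp add: E_def[abs_def])
  qed
  have E_bound: "AE \<omega> in M. \<bar>E k \<omega>\<bar> \<le> c k" for k
    using assms(7)[of k] assms(8)[of k]
    by eventually_elim (auto simp: E_def c_def abs_mult intro!: mult_left_mono relative_error_bound)

  have root: "sqrt (\<Sum>k\<in>UNIV. (c k)\<^sup>2) = norm (x \<circ>\<^sub>H y) * (u * (2 + u))"
    using assms(3)
    by (simp add: c_def norm_hadamard power_mult_distrib real_sqrt_mult flip: sum_distrib_right)
  \<comment> \<open>The error bounds \<open>c k\<close> cannot all vanish, since some product of components is nonzero.\<close>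
  have "norm (x \<circ>\<^sub>H y) > 0"
    using assms(2) hadamard_eq_0_imp_inner_eq_0[of x y] by auto
  then have "sqrt (\<Sum>k\<in>UNIV. (c k)\<^sup>2) > 0"
    unfolding root using assms(3) by simp
  then have "prob {\<omega>\<in>space M. \<bar>\<Sum>k\<in>UNIV. E k \<omega>\<bar>
      \<le> sqrt (2 * ln (2 / \<eta>)) * sqrt (\<Sum>k\<in>UNIV. (c k)\<^sup>2)} \<ge> 1 - \<eta>"
    by (intro Hoeffding_confidence_bound E_indep E_bound E_mean assms(9,10)) auto
  also have "{\<omega>\<in>space M. \<bar>\<Sum>k\<in>UNIV. E k \<omega>\<bar>
                \<le> sqrt (2 * ln (2 / \<eta>)) * sqrt (\<Sum>k\<in>UNIV. (c k)\<^sup>2)}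
           = {\<omega>\<in>space M. \<bar>(perturbed \<delta> x \<omega> \<bullet> perturbed \<theta> y \<omega> - x \<bullet> y) / (x \<bullet> y)\<bar>
                \<le> norm (x \<circ>\<^sub>H y) / \<bar>x \<bullet> y\<bar> * sqrt (2 * ln (2 / \<eta>)) * u * (2 + u)}"
    unfolding root inner_perturbed_diff E_def[symmetric]
    using assms(2) by (simp add: pos_divide_le_eq mult_ac)
  finally show ?thesis
    by (simp add: norm_hadamard)
qed

end
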